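(* Let $n_c\ge 2$, $n_v\ge 1$, $N\ge 1$, let $P_{ij}$ ($1\le i\le n_c$, $1\le j\le n_v$) be arbitrary $N\times N$ permutation matrices, and let $H=(P_{ij})$ be the resulting $n_cN\times n_vN$ $0/1$ matrix. Let $C_H$ be the $n_cN\times n_cN$ block matrix whose diagonal $N\times N$ blocks are $0$ and whose $(i,j)$ block, $i\ne j$, is $C_{ij}=\sum_{k=1}^{n_v}P_{ik}P_{jk}^{\mathsf T}$ (computed over $\mathbb Z$). Then for every integer $l\ge 2$, the Tanner graph of $H$ satisfies $\mathrm{girth}(H)>2l$ if and only if, for all $t=2,3,\ldots,l$, $$(C_H)^{\lfloor t/2\rfloor}\,H^{(t \bmod 2)}\ \triangle\ \left(I+C_H+C_H^2+\cdots+C_H^{\lfloor t/2\rfloor-1}\right)H^{(t\bmod 2)}=0 .$$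
   Context: The Tanner graph of a matrix with non-negative integer entries is the bipartite (multi)graph with one check node per row, one variable node per column, and as many edges between check node $a$ and variable node $b$ as the $(a,b)$ entry. $\mathrm{girth}(M)$ is the length of a shortest cycle in the Tanner graph of $M$ ($+\infty$ if there is none). For non-negative integers $e,f$, $e\triangle f:=1$ if $e\ge 2$ and $f=0$, and $e\triangle f:=0$ otherwise; for matrices of equal size with non-negative integer entries, $\triangle$ is applied entrywise. All matrix sums and products are over $\mathbb Z$; $H^0$ is to be read as the absence of the factor (identity matrix of size $n_cN$) and $H^1=H$. *)

theory Defs
  imports
    "Jordan_Normal_Form.Matrix"
    "HOL-Combinatorics.Permutations"
    "HOL-Library.Extended_Nat"
begin

definition permutation_matrix :: "nat \<Rightarrow> int mat \<Rightarrow> bool" where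
  "permutation_matrix N A \<longleftrightarrow>
     (\<exists>\<pi>. \<pi> permutes {..<N} \<and> A = mat N N (\<lambda>(i, j). if \<pi> i = j then 1 else 0))"

(* Finite sum of nr x nc matrices; the dimensions are explicit because they are not
   determined by an empty family. *)
definition mat_sum :: "nat \<Rightarrow> nat \<Rightarrow> ('k \<Rightarrow> int mat) \<Rightarrow> 'k set \<Rightarrow> int mat" where
  "mat_sum nr nc F K = mat nr nc (\<lambda>(i, j). \<Sum>k\<in>K. F k $$ (i, j))"

(* Block matrix with r x c blocks of size N x N; block indices start at 0. *)
definition block_matrix :: "nat \<Rightarrow> nat \<Rightarrow> nat \<Rightarrow> (nat \<Rightarrow> nat \<Rightarrow> int mat) \<Rightarrow> int mat" where
  "block_matrix r c N B =
     mat (r * N) (c * N) (\<lambda>(a, b). B (a div N) (b div N) $$ (a mod N, b mod N))"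

definition C_block :: "nat \<Rightarrow> nat \<Rightarrow> (nat \<Rightarrow> nat \<Rightarrow> int mat) \<Rightarrow> nat \<Rightarrow> nat \<Rightarrow> int mat" where
  "C_block nv N P i j = mat_sum N N (\<lambda>k. P i k * transpose_mat (P j k)) {..<nv}"

definition C_matrix :: "nat \<Rightarrow> nat \<Rightarrow> nat \<Rightarrow> (nat \<Rightarrow> nat \<Rightarrow> int mat) \<Rightarrow> int mat" where
  "C_matrix nc nv N P =
     block_matrix nc nc N (\<lambda>i j. if i = j then 0\<^sub>m N N else C_block nv N P i j)"

definition tri :: "int \<Rightarrow> int \<Rightarrow> int" where
  "tri e f = (if e \<ge> 2 \<and> f = 0 then 1 else 0)"

definition mat_tri :: "int mat \<Rightarrow> int mat \<Rightarrow> int mat" (infix \<open>\<triangle>\<close> 55) where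
  "A \<triangle> B = mat (dim_row A) (dim_col A) (\<lambda>ij. tri (A $$ ij) (B $$ ij))"

datatype tanner_node = Check nat | Variable nat

(* The triple (a, b, k) is the k-th of the M $$ (a, b) parallel edges between check node a
   and variable node b. *)
definition tanner_edges :: "int mat \<Rightarrow> (nat \<times> nat \<times> nat) set" where
  "tanner_edges M = {(a, b, k). a < dim_row M \<and> b < dim_col M \<and> int k < M $$ (a, b)}"

definition edge_ends :: "nat \<times> nat \<times> nat \<Rightarrow> tanner_node set" where
  "edge_ends = (\<lambda>(a, b, k). {Check a, Variable b})"

(* A cycle is given by its distinct nodes and distinct edges in cyclic order, so two
   parallel edges form a cycle of length 2, whereas traversing one edge back and forth
   is not a cycle. *)
definition tanner_cycle ::
    "int mat \<Rightarrow> tanner_node list \<Rightarrow> (nat \<times> nat \<times> nat) list \<Rightarrow> bool" where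
  "tanner_cycle M vs es \<longleftrightarrow>
     vs \<noteq> [] \<and> length es = length vs \<and> distinct vs \<and> distinct es \<and> set es \<subseteq> tanner_edges M \<and>
     (\<forall>i < length vs. edge_ends (es ! i) = {vs ! i, vs ! (Suc i mod length vs)})"

(* The infimum of the empty set in enat is \<infinity>. *)
definition girth :: "int mat \<Rightarrow> enat" where
  "girth M = Inf {enat (length vs) | vs es. tanner_cycle M vs es}"

end

theory Submission
  imports Defs
begin

text \<open>
  Up to its diagonal, the matrix C is the product of H and its transpose, so the entries of
  the powers of C (times H) count the walks in the Tanner graph that start at a check node
  and never backtrack at a variable node; they may still backtrack at a check node. If an
  entry is at least 2 and no shorter walk of the same parity joins its endpoints, then no walk
  counted there backtracks at all, since cutting out a backtracking step would produce a
  shorter walk. Two distinct non-backtracking walks with common endpoints, once their common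
  suffix is removed, concatenate to a closed non-backtracking walk, which contains a cycle.
  Conversely, the two halves of a shortest cycle, started at a check node, make the
  corresponding entry at least 2, and a shorter walk between the antipodal nodes would
  together with one half yield a shorter cycle.
\<close>

subsection \<open>Non-backtracking walks and cycles\<close>

text \<open>Walks are functions on all naturals of which only the values up to the length matter.
  Two walks therefore count as different only if they differ at such a position.\<close>

definition walk :: "('a \<Rightarrow> 'a \<Rightarrow> bool) \<Rightarrow> (nat \<Rightarrow> 'a) \<Rightarrow> nat \<Rightarrow> bool" where
  "walk E p n \<longleftrightarrow> (\<forall>i<n. E (p i) (p (Suc i)))"

definition nonbacktracking :: "(nat \<Rightarrow> 'a) \<Rightarrow> nat \<Rightarrow> bool" where
  "nonbacktracking p n \<longleftrightarrow> (\<forall>i. i + 2 \<le> n \<longrightarrow> p i \<noteq> p (i + 2))"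

text \<open>Cycles of a simple graph given by its adjacency relation; without the bound on the
  length, an edge run back and forth would qualify.\<close>

definition cycle :: "('a \<Rightarrow> 'a \<Rightarrow> bool) \<Rightarrow> (nat \<Rightarrow> 'a) \<Rightarrow> nat \<Rightarrow> bool" where
  "cycle E c n \<longleftrightarrow> 3 \<le> n \<and> inj_on c {..<n} \<and> c n = c 0 \<and> walk E c n"

text \<open>Take a repetition with the smallest gap inside the given one: the segment between its
  ends is injective. Gap 1 would be a loop and gap 2 a backtracking step, so the gap is at least
  3.\<close>

lemma nonbacktracking_repetition_cycle:
  assumes irr: "\<And>x. \<not> E x x"
    and "walk E p n" "nonbacktracking p n" "i < j" "j \<le> n" "p i = p j"
  shows "\<exists>c k. k \<le> n \<and> cycle E c k"
  using assms(4-6)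
proof (induction "j - i" arbitrary: i j rule: less_induct)
  case less
  show ?case
  proof (cases "\<exists>i' j'. i \<le> i' \<and> i' < j' \<and> j' \<le> j \<and> p i' = p j' \<and> j' - i' < j - i")
    case True
    then show ?thesis using less by (meson le_trans)
  next
    case False
    have "inj_on (\<lambda>k. p (i + k)) {..<j - i}"
    proof (rule linorder_inj_onI')
      fix a b assume "a \<in> {..<j - i}" "b \<in> {..<j - i}" "a < b"
      then show "p (i + a) \<noteq> p (i + b)"
        using False[unfolded not_ex, rule_format, of "i + a" "i + b"] by auto
    qed
    moreover have "walk E (\<lambda>k. p (i + k)) (j - i)"
      using assms(2) less.prems by (auto simp: walk_def)
    moreover have "3 \<le> j - i"
    proof (rule ccontr)
      assume "\<not> 3 \<le> j - i"
      with less.prems(1) have "j = Suc i \<or> j = i + 2" by arith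
      then show False
        using less.prems assms(1-3) by (metis Suc_le_lessD nonbacktracking_def walk_def)
    qed
    ultimately have "cycle E (\<lambda>k. p (i + k)) (j - i)"
      using less.prems by (simp add: cycle_def)
    then show ?thesis using less.prems by (meson diff_le_self le_trans)
  qed
qed

text \<open>Induction strips common last steps. Once the last steps differ, \<open>p\<close>
  followed by the reverse of \<open>q\<close> does not backtrack at the junction and returns to its
  start, which is a repetition. Nothing is required at the common start, where the two walks may
  share an edge.\<close>

lemma distinct_walks_cycle:
  assumes irr: "\<And>x. \<not> E x x" and sym: "\<And>x y. E x y \<Longrightarrow> E y x"
    and "walk E p s" "nonbacktracking p s" "walk E q t" "nonbacktracking q t"
    and "p 0 = q 0" "p s = q t" "s \<noteq> t \<or> (\<exists>i\<le>s. p i \<noteq> q i)"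
  shows "\<exists>c k. k \<le> s + t \<and> cycle E c k"
  using assms(3-)
proof (induction s arbitrary: t)
  case 0
  then have "0 < t" by auto
  then show ?case
    using nonbacktracking_repetition_cycle[where E = E, OF irr, of q t 0 t] 0 by auto
next
  case (Suc s)
  show ?case
  proof (cases "t > 0 \<and> p s = q (t - 1)")
    case True
    then obtain t' where t: "t = Suc t'" by (cases t) auto
    \<comment> \<open>The dropped final nodes agree, so the walks must already differ in what
      remains.\<close>
    have "s \<noteq> t' \<or> (\<exists>i\<le>s. p i \<noteq> q i)"
      using Suc.prems t by (metis le_Suc_eq)
    then have "\<exists>c k. k \<le> s + t' \<and> cycle E c k"
      using Suc.prems True t by (intro Suc.IH) (auto simp: walk_def nonbacktracking_def)
    then show ?thesis using t by (metis add_Suc add_Suc_right le_SucI)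
  next
    case False
    \<comment> \<open>Out along \<open>p\<close>, back along \<open>q\<close>; both formulas agree
      at the junction \<open>Suc s\<close> because the walks end at the same node.\<close>
    define c where "c i = (if i \<le> Suc s then p i else q (Suc s + t - i))" for i
    have c_q: "c i = q (Suc s + t - i)" if "Suc s \<le> i" for i
      using that Suc.prems by (cases "i = Suc s") (auto simp: c_def)
    have "walk E c (Suc s + t)"
      unfolding walk_def
    proof (intro allI impI)
      fix i assume i: "i < Suc s + t"
      show "E (c i) (c (Suc i))"
      proof (cases "Suc i \<le> Suc s")
        case True
        then show ?thesis using Suc.prems(1) by (auto simp: walk_def c_def)
      next
        case False
        have "Suc s + t - i = Suc (Suc s + t - Suc i)" "Suc s + t - Suc i < t"
          using i False by auto
        then have "E (q (Suc s + t - Suc i)) (q (Suc s + t - i))"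
          using Suc.prems(3) by (metis walk_def)
        then show ?thesis using sym c_q False by simp
      qed
    qed
    moreover have "nonbacktracking c (Suc s + t)"
      unfolding nonbacktracking_def
    proof (intro allI impI)
      fix i assume i: "i + 2 \<le> Suc s + t"
      \<comment> \<open>The three nodes lie on \<open>p\<close>, are centred at the junction, or lie
        on \<open>q\<close>. Only the junction uses that the last steps differ; there the bound on
        \<open>i\<close> also forces \<open>t > 0\<close>.\<close>
      consider "i + 2 \<le> Suc s" | "i = s" | "i > s" by linarith
      then show "c i \<noteq> c (i + 2)"
      proof cases
        case 1
        then show ?thesis using Suc.prems(2) by (auto simp: nonbacktracking_def c_def)
      next
        case 2
        then show ?thesis using False i by (simp add: c_def)
      next
        case 3
        then have "Suc s + t - i = Suc s + t - (i + 2) + 2" "Suc s + t - (i + 2) + 2 \<le> t"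
          using i by auto
        then have "q (Suc s + t - (i + 2)) \<noteq> q (Suc s + t - i)"
          using Suc.prems(4) by (metis nonbacktracking_def)
        then show ?thesis using c_q 3 by auto
      qed
    qed
    moreover have "c 0 = c (Suc s + t)" using Suc.prems by (simp add: c_q) (simp add: c_def)
    ultimately show ?thesis
      using nonbacktracking_repetition_cycle[where E = E, OF irr, of c "Suc s + t" 0 "Suc s + t"] by auto
  qed
qed

text \<open>Each cut replaces a detour x, y, x by x and lowers the length by 2, which preserves its
  parity. The last clause records that an unchanged length means that no cut was possible.\<close>

lemma walk_shorten:
  assumes "walk E p n"
  shows "\<exists>q s. s \<le> n \<and> even (n - s) \<and> walk E q s \<and> nonbacktracking q s \<and> q 0 = p 0 \<and> q s = p n
     \<and> (s = n \<longrightarrow> nonbacktracking p n)"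
  using assms
proof (induction n arbitrary: p rule: less_induct)
  case (less n)
  show ?case
  proof (cases "nonbacktracking p n")
    case True
    then show ?thesis using less.prems by (intro exI[of _ p] exI[of _ n]) simp
  next
    case False
    then obtain i where i: "i + 2 \<le> n" "p i = p (i + 2)" by (auto simp: nonbacktracking_def)
    \<comment> \<open>Positions \<open>i + 1\<close> and \<open>i + 2\<close> are removed; adjacency
      at the seam holds because \<open>p i = p (i + 2)\<close>.\<close>
    define q where "q j = (if j \<le> i then p j else p (j + 2))" for j
    have "walk E q (n - 2)"
      unfolding walk_def
    proof (intro allI impI)
      fix j assume "j < n - 2"
      then show "E (q j) (q (Suc j))"
        using less.prems i by (cases "j = i") (auto simp: walk_def q_def)
    qed
    moreover have "n - 2 < n" using i by simp
    ultimately obtain r s where r: "s \<le> n - 2" "even (n - 2 - s)" "walk E r s" "nonbacktracking r s"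
      "r 0 = q 0" "r s = q (n - 2)" using less.IH by blast
    have "r s = p n" using r(6) i le_add_diff_inverse2[of 2 n] by (cases "n = i + 2") (auto simp: q_def)
    moreover have "n - s = n - 2 - s + 2" using r(1) i by arith
    ultimately show ?thesis using r i by (intro exI[of _ r] exI[of _ s]) (auto simp: q_def)
  qed
qed

text \<open>
  The counterparts of the walks counted by the matrix products: for a walk starting at a check
  node, the even positions are the check nodes, so that exactly backtracking at variable
  nodes is excluded.
\<close>

definition check_walk :: "('a \<Rightarrow> 'a \<Rightarrow> bool) \<Rightarrow> nat \<Rightarrow> 'a \<Rightarrow> 'a \<Rightarrow> (nat \<Rightarrow> 'a) \<Rightarrow> bool" where
  "check_walk E n x y p \<longleftrightarrow>
     walk E p n \<and> (\<forall>i. even i \<and> i + 2 \<le> n \<longrightarrow> p i \<noteq> p (i + 2)) \<and> p 0 = x \<and> p n = y"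

definition reach :: "('a \<Rightarrow> 'a \<Rightarrow> bool) \<Rightarrow> nat \<Rightarrow> 'a \<Rightarrow> 'a \<Rightarrow> bool" where
  "reach E n x y \<longleftrightarrow> (\<exists>p. check_walk E n x y p)"

definition multi_reach :: "('a \<Rightarrow> 'a \<Rightarrow> bool) \<Rightarrow> nat \<Rightarrow> 'a \<Rightarrow> 'a \<Rightarrow> bool" where
  "multi_reach E n x y \<longleftrightarrow>
     (\<exists>p q. check_walk E n x y p \<and> check_walk E n x y q \<and> (\<exists>i\<le>n. p i \<noteq> q i))"

lemma multi_reach_imp_reach: "multi_reach E n x y \<Longrightarrow> reach E n x y"
  unfolding multi_reach_def reach_def by blast

section \<open>Concatenation and splitting of check walks\<close>

definition append_walk :: "nat \<Rightarrow> (nat \<Rightarrow> 'a) \<Rightarrow> (nat \<Rightarrow> 'a) \<Rightarrow> nat \<Rightarrow> 'a" where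
  "append_walk s p q i = (if i \<le> s then p i else q (i - s))"

text \<open>For even \<open>s\<close> the junction is the middle of the triple starting at the odd
  position \<open>s - 1\<close>, where backtracking is allowed. So no condition straddles the
  junction, and the shift by \<open>s\<close> keeps the parity of the positions in
  \<open>q\<close>.\<close>

lemma check_walk_append:
  assumes "even s" "check_walk E s x z p" "check_walk E r z y q"
  shows "check_walk E (s + r) x y (append_walk s p q)"
proof -
  have right: "append_walk s p q i = q (i - s)" if "s \<le> i" for i
    using that assms by (cases "i = s") (auto simp: append_walk_def check_walk_def)
  have left: "append_walk s p q i = p i" if "i \<le> s" for i
    using that by (simp add: append_walk_def)
  have "E (append_walk s p q i) (append_walk s p q (Suc i))" if "i < s + r" for i
  proof (cases "i < s")
    case True
    then show ?thesis using assms by (auto simp: left check_walk_def walk_def)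
  next
    case False
    then show ?thesis using assms that by (auto simp: right check_walk_def walk_def Suc_diff_le)
  qed
  moreover have "append_walk s p q i \<noteq> append_walk s p q (i + 2)" if "even i" "i + 2 \<le> s + r" for i
  proof (cases "i < s")
    case True
    then have "i + 2 \<le> s" using \<open>even s\<close> \<open>even i\<close> by presburger
    then show ?thesis using assms that by (auto simp: left check_walk_def)
  next
    case False
    then have "even (i - s)" "i - s + 2 \<le> r" "i + 2 - s = i - s + 2" using that \<open>even s\<close> by auto
    then show ?thesis using assms(3) False by (auto simp: right check_walk_def)
  qed
  ultimately show ?thesis
    using assms by (auto simp: check_walk_def walk_def left right)
qed

lemma check_walk_split:
  assumes "even s" "check_walk E (s + r) x y p"
  shows "check_walk E s x (p s) p" "check_walk E r (p s) y (\<lambda>i. p (s + i))"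
  using assms by (auto simp: check_walk_def walk_def)

lemma reach_add:
  assumes "even s"
  shows "reach E (s + r) x y \<longleftrightarrow> (\<exists>z. reach E s x z \<and> reach E r z y)"
proof
  assume "reach E (s + r) x y"
  then obtain p where "check_walk E (s + r) x y p" by (auto simp: reach_def)
  from check_walk_split[OF assms this] show "\<exists>z. reach E s x z \<and> reach E r z y"
    unfolding reach_def by blast
next
  assume "\<exists>z. reach E s x z \<and> reach E r z y"
  then obtain z p q where "check_walk E s x z p" "check_walk E r z y q" by (auto simp: reach_def)
  from check_walk_append[OF assms this] show "reach E (s + r) x y" unfolding reach_def by blast
qed

text \<open>Two different walks either pass through different nodes at position \<open>s\<close> or
  differ in one of their two parts. The right-hand side has the shape of the criterion for a sum of
  products of non-negative integers to be at least 2.\<close>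

lemma multi_reach_add:
  assumes "even s"
  shows "multi_reach E (s + r) x y \<longleftrightarrow>
    (\<exists>z z'. reach E s x z \<and> reach E r z y \<and> reach E s x z' \<and> reach E r z' y \<and>
       (z \<noteq> z' \<or> multi_reach E s x z \<or> multi_reach E r z y))" (is "?L \<longleftrightarrow> ?R")
proof
  assume ?L
  then obtain p q i where pq: "check_walk E (s + r) x y p" "check_walk E (s + r) x y q"
    "i \<le> s + r" "p i \<noteq> q i" by (auto simp: multi_reach_def)
  note split = check_walk_split[OF assms pq(1)] check_walk_split[OF assms pq(2)]
  have "multi_reach E s x (p s) \<or> multi_reach E r (p s) y" if "p s = q s"
  proof (cases "i \<le> s")
    case True
    then show ?thesis using split pq that unfolding multi_reach_def by metis
  next
    case False
    then have "i - s \<le> r" "p (s + (i - s)) \<noteq> q (s + (i - s))" using pq by auto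
    then show ?thesis using split that unfolding multi_reach_def by metis
  qed
  then show ?R using split unfolding reach_def by blast
next
  assume ?R
  then obtain z z' p p' q q' where
    w: "check_walk E s x z p" "check_walk E r z y q" "check_walk E s x z' p'" "check_walk E r z' y q'"
    and d: "z \<noteq> z' \<or> multi_reach E s x z \<or> multi_reach E r z y"
    by (auto simp: reach_def)
  have multi: ?L if "check_walk E s x u f" "check_walk E r u y g" "check_walk E s x u' f'"
    "check_walk E r u' y g'" "append_walk s f g i \<noteq> append_walk s f' g' i" "i \<le> s + r" for u u' f g f' g' i
    using check_walk_append[OF assms that(1,2)] check_walk_append[OF assms that(3,4)] that(5,6)
    unfolding multi_reach_def by blast
  from d consider "z \<noteq> z'" | "multi_reach E s x z" | "multi_reach E r z y" by blast
  then show ?L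
  proof cases
    case 1
    then show ?thesis using w by (intro multi[OF w, of s]) (auto simp: append_walk_def check_walk_def)
  next
    case 2
    then obtain f g i where "check_walk E s x z f" "check_walk E s x z g" "i \<le> s" "f i \<noteq> g i"
      by (auto simp: multi_reach_def)
    then show ?thesis using w by (intro multi[of z f q z g q i]) (auto simp: append_walk_def)
  next
    case 3
    then obtain f g i where fg: "check_walk E r z y f" "check_walk E r z y g" "i \<le> r" "f i \<noteq> g i"
      by (auto simp: multi_reach_def)
    \<comment> \<open>\<open>append_walk\<close> takes position \<open>s\<close> from its first
      part, so the difference must lie beyond the common start of the second parts.\<close>
    then have "i \<noteq> 0" by (metis check_walk_def)
    with fg show ?thesis using w by (intro multi[of z p f z p g "s + i"]) (auto simp: append_walk_def)
  qed
qed

subsection \<open>Walks and cycles in Tanner graphs\<close>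

text \<open>Adjacency forgets edge multiplicities. For 0/1 matrices there are no parallel edges, so
  the simple-graph results above apply.\<close>

fun tanner_adj :: "int mat \<Rightarrow> tanner_node \<Rightarrow> tanner_node \<Rightarrow> bool" where
  "tanner_adj M (Check a) (Variable b) \<longleftrightarrow> a < dim_row M \<and> b < dim_col M \<and> 0 < M $$ (a, b)"
| "tanner_adj M (Variable b) (Check a) \<longleftrightarrow> a < dim_row M \<and> b < dim_col M \<and> 0 < M $$ (a, b)"
| "tanner_adj M _ _ \<longleftrightarrow> False"

lemma tanner_adj_irrefl: "\<not> tanner_adj M x x"
  by (cases x) auto

lemma tanner_adj_sym: "tanner_adj M x y \<Longrightarrow> tanner_adj M y x"
  by (cases x; cases y) auto

lemma tanner_adj_Check: "tanner_adj M (Check a) y \<longleftrightarrow>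
    (\<exists>b. y = Variable b \<and> a < dim_row M \<and> b < dim_col M \<and> 0 < M $$ (a, b))"
  by (cases y) auto

lemma tanner_adj_Variable: "tanner_adj M (Variable b) y \<longleftrightarrow>
    (\<exists>a. y = Check a \<and> a < dim_row M \<and> b < dim_col M \<and> 0 < M $$ (a, b))"
  by (cases y) auto

lemma walk_alternates:
  assumes "walk (tanner_adj M) p n" "i \<le> n"
  shows "(\<exists>a. p i = Check a) \<longleftrightarrow> ((\<exists>a. p 0 = Check a) \<longleftrightarrow> even i)"
  using assms(2)
proof (induction i)
  case (Suc i)
  then have "tanner_adj M (p i) (p (Suc i))" using assms(1) by (simp add: walk_def)
  then have "(\<exists>a. p (Suc i) = Check a) \<longleftrightarrow> \<not> (\<exists>a. p i = Check a)"
    by (cases "p i"; cases "p (Suc i)") auto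
  then show ?case using Suc by auto
qed simp

text \<open>Bipartiteness fixes the kind of the end node, and its last edge bounds the index; for
  length 0 the bound is that of the start. This makes midpoints of walks range over the summation
  indices of a matrix product.\<close>

lemma reach_even_Check:
  assumes "reach (tanner_adj M) s (Check a) z" "even s" "a < dim_row M"
  shows "\<exists>i<dim_row M. z = Check i"
proof -
  obtain p where p: "walk (tanner_adj M) p s" "p 0 = Check a" "p s = z"
    using assms by (auto simp: reach_def check_walk_def)
  then obtain i where i: "z = Check i" using walk_alternates[OF p(1), of s] assms(2) by auto
  show ?thesis
  proof (cases s)
    case 0
    then show ?thesis using p assms by auto
  next
    case (Suc s')
    then have "tanner_adj M (p s') (Check i)" using p i by (auto simp: walk_def)
    then show ?thesis using i by (cases "p s'") auto
  qed
qed

section \<open>Short cycles versus multiple check walks\<close>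

lemma cycle_rotate:
  assumes "cycle E c n"
  shows "cycle E (\<lambda>i. c (Suc i mod n)) n"
proof -
  have n: "3 \<le> n" and inj: "inj_on c {..<n}" using assms by (auto simp: cycle_def)
  have "inj_on (\<lambda>i. Suc i mod n) {..<n}"
    by (rule inj_onI) (auto simp: mod_Suc split: if_splits)
  then have "inj_on (c \<circ> (\<lambda>i. Suc i mod n)) {..<n}"
    using n by (intro comp_inj_on inj_on_subset[OF inj]) auto
  moreover have "E (c (Suc i mod n)) (c (Suc (Suc i) mod n))" if "i < n" for i
  proof (cases "Suc i = n")
    case True
    then show ?thesis using assms n by (auto simp: cycle_def walk_def mod_Suc)
  next
    case False
    then have "Suc i < n" "c (Suc (Suc i) mod n) = c (Suc (Suc i))"
      using that assms by (auto simp: cycle_def mod_Suc)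
    then show ?thesis using assms by (auto simp: cycle_def walk_def)
  qed
  ultimately show ?thesis using n by (auto simp: cycle_def walk_def comp_def mod_Suc)
qed

lemma cycle_nonbacktracking:
  assumes "cycle E c n"
  shows "nonbacktracking c n"
  unfolding nonbacktracking_def
proof (intro allI impI)
  fix i assume "i + 2 \<le> n"
  \<comment> \<open>When \<open>i + 2 = n\<close> the later node is \<open>c 0\<close>; since
    \<open>n\<close> is at least 3, \<open>i\<close> is then positive and injectivity still
    separates the two nodes.\<close>
  then consider "i + 2 < n" | "i + 2 = n" "0 < i" using assms by (force simp: cycle_def)
  then show "c i \<noteq> c (i + 2)"
    using assms by cases (auto simp: cycle_def inj_on_eq_iff)
qed

lemma tanner_cycle_even:
  assumes "cycle (tanner_adj M) c n"
  shows "even n"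
  using walk_alternates[of M c n n] assms by (auto simp: cycle_def)

lemma short_cycle_from_multi_reach:
  assumes "multi_reach (tanner_adj M) t x y"
    and no: "\<And>s. s < t \<Longrightarrow> even (t - s) \<Longrightarrow> \<not> reach (tanner_adj M) s x y"
  shows "\<exists>c n. n \<le> 2 * t \<and> cycle (tanner_adj M) c n"
proof -
  let ?E = "tanner_adj M"
  obtain p q where pq: "check_walk ?E t x y p" "check_walk ?E t x y q" "\<exists>i\<le>t. p i \<noteq> q i"
    using assms(1) by (auto simp: multi_reach_def)
  have "nonbacktracking f t" if f: "check_walk ?E t x y f" for f
  proof -
    have "walk ?E f t" using f by (simp add: check_walk_def)
    from walk_shorten[OF this] obtain g s where g: "s \<le> t" "even (t - s)" "walk ?E g s"
      "nonbacktracking g s" "g 0 = f 0" "g s = f t" "s = t \<longrightarrow> nonbacktracking f t" by blast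
    \<comment> \<open>A walk without any backtracking is in particular a check walk, so
      \<open>no\<close> forbids that shortening made \<open>f\<close> strictly shorter.\<close>
    then have "reach ?E s x y"
      using f by (auto simp: reach_def check_walk_def nonbacktracking_def intro!: exI[of _ g])
    then have "s = t" using no g by (meson le_neq_implies_less)
    then show ?thesis using g by simp
  qed
  then have "\<exists>c k. k \<le> t + t \<and> cycle ?E c k"
    using pq by (intro distinct_walks_cycle[where E = ?E, OF tanner_adj_irrefl tanner_adj_sym, of p t q t])
      (auto simp: check_walk_def)
  then show ?thesis by (simp add: mult_2)
qed

text \<open>The node \<open>c t\<close> is antipodal to the start, and the two halves of the cycle
  are different walks to it. A walk of length below \<open>t\<close> would close up with one half to
  a cycle shorter than \<open>2 * t\<close>.\<close>

lemma multi_reach_from_shortest_cycle: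
  assumes c: "cycle (tanner_adj M) c (2 * t)" "c 0 = Check a"
    and shortest: "\<And>d k. cycle (tanner_adj M) d k \<Longrightarrow> 2 * t \<le> k"
  shows "multi_reach (tanner_adj M) t (Check a) (c t)"
    and "\<And>s. s < t \<Longrightarrow> \<not> reach (tanner_adj M) s (Check a) (c t)"
proof -
  let ?E = "tanner_adj M"
  define q where "q i = c (2 * t - i)" for i
  have t: "2 \<le> t" and inj: "inj_on c {..<2 * t}" and w: "walk ?E c (2 * t)" and c0: "c (2 * t) = c 0"
    using c by (auto simp: cycle_def)
  have nb: "nonbacktracking c (2 * t)" using c cycle_nonbacktracking by blast
  then have p: "walk ?E c t" "nonbacktracking c t" using w by (auto simp: walk_def nonbacktracking_def)
  have "?E (q i) (q (Suc i))" if "i < t" for i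
  proof -
    have "2 * t - i = Suc (2 * t - Suc i)" "2 * t - Suc i < 2 * t" using that by auto
    then have "?E (c (2 * t - Suc i)) (c (2 * t - i))" using w by (metis walk_def)
    then show ?thesis by (simp add: q_def tanner_adj_sym)
  qed
  moreover have "q i \<noteq> q (i + 2)" if "i + 2 \<le> t" for i
  proof -
    have "2 * t - i = 2 * t - (i + 2) + 2" "2 * t - (i + 2) + 2 \<le> 2 * t" using that by auto
    then have "c (2 * t - (i + 2)) \<noteq> c (2 * t - i)" using nb by (metis nonbacktracking_def)
    then show ?thesis by (simp add: q_def)
  qed
  moreover have "q 0 = c 0" "q t = c t" by (simp_all add: q_def c0)
  \<comment> \<open>\<open>q 1\<close> is \<open>c (2 * t - 1)\<close>, and \<open>t\<close> being
    at least 2 makes the positions 1 and \<open>2 * t - 1\<close> different.\<close>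
  moreover have "c 1 \<noteq> q 1" using inj_onD[OF inj, of 1 "2 * t - 1"] t by (auto simp: q_def)
  ultimately show "multi_reach ?E t (Check a) (c t)"
    using p c(2) t unfolding multi_reach_def check_walk_def
    by (intro exI[of _ c] exI[of _ q] conjI exI[of _ 1]) (auto simp: walk_def nonbacktracking_def)
  show "\<not> reach ?E s (Check a) (c t)" if "s < t" for s
  proof
    assume "reach ?E s (Check a) (c t)"
    then obtain f where "walk ?E f s" "f 0 = Check a" "f s = c t"
      by (auto simp: reach_def check_walk_def)
    with walk_shorten[of ?E f s] obtain g s' where "s' \<le> s" "walk ?E g s'" "nonbacktracking g s'"
      "g 0 = Check a" "g s' = c t" by auto
    \<comment> \<open>The lengths \<open>t\<close> and \<open>s'\<close> differ, so the two walks
      are automatically distinct.\<close>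
    then have "\<exists>d k. k \<le> t + s' \<and> cycle ?E d k" "s' < t"
      using p c(2) that
      by (auto intro!: distinct_walks_cycle[where E = ?E, OF tanner_adj_irrefl tanner_adj_sym, of c t g s'])
    then show False using shortest by fastforce
  qed
qed

text \<open>A violation at \<open>t\<close> yields a cycle of length at most \<open>2 * t\<close>;
  conversely, a shortest cycle of length \<open>2 * t\<close> violates the condition at this very
  \<open>t\<close>. Hence all \<open>t\<close> up to \<open>l\<close> have to be tested.\<close>

lemma no_short_cycle_iff:
  "\<not> (\<exists>c n. n \<le> 2 * l \<and> cycle (tanner_adj M) c n) \<longleftrightarrow>
   (\<forall>t\<in>{2..l}. \<forall>a<dim_row M. \<forall>y. multi_reach (tanner_adj M) t (Check a) y \<longrightarrow>
      (\<exists>s<t. even (t - s) \<and> reach (tanner_adj M) s (Check a) y))" (is "?L \<longleftrightarrow> ?R")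
proof
  assume ?L
  then show ?R using short_cycle_from_multi_reach[of M]
    by (meson atLeastAtMost_iff le_trans mult_le_mono2)
next
  assume R: ?R
  show ?L
  proof
    assume "\<exists>c n. n \<le> 2 * l \<and> cycle (tanner_adj M) c n"
    define g where "g = (LEAST n. \<exists>c. cycle (tanner_adj M) c n)"
    have least: "g \<le> n" if "cycle (tanner_adj M) c n" for c n
      unfolding g_def using that by (auto intro: Least_le)
    then have "g \<le> 2 * l" using \<open>\<exists>c n. _\<close> by fastforce
    obtain c0 where c0: "cycle (tanner_adj M) c0 g"
      using \<open>\<exists>c n. _\<close> LeastI[of "\<lambda>n. \<exists>c. cycle (tanner_adj M) c n"] unfolding g_def by blast
    obtain c a where c: "cycle (tanner_adj M) c g" "c 0 = Check a"
    proof (cases "c0 0")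
      case (Check a)
      then show ?thesis using that c0 by blast
    next
      case (Variable b)
      then have "\<exists>a. c0 1 = Check a"
        using walk_alternates[of M c0 g 1] c0 by (auto simp: cycle_def)
      moreover have "1 < g" using c0 by (auto simp: cycle_def)
      \<comment> \<open>By bipartiteness, rotating by one position makes the cycle start at a check
        node.\<close>
      ultimately show ?thesis using that[OF cycle_rotate[OF c0]] by auto
    qed
    obtain t where t: "g = 2 * t" using tanner_cycle_even[OF c(1)] by blast
    note c = c[unfolded t] and least = least[unfolded t]
    have "tanner_adj M (Check a) (c (Suc 0))" using c by (force simp: cycle_def walk_def)
    then have "a < dim_row M" by (cases "c (Suc 0)") auto
    moreover have "t \<in> {2..l}" using c \<open>g \<le> 2 * l\<close> t by (auto simp: cycle_def)
    ultimately show False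
      using R multi_reach_from_shortest_cycle[OF c] least by blast
  qed
qed

section \<open>Girth in terms of simple-graph cycles\<close>

definition zero_one_mat :: "int mat \<Rightarrow> bool" where
  "zero_one_mat M \<longleftrightarrow> (\<forall>a<dim_row M. \<forall>b<dim_col M. M $$ (a, b) \<in> {0, 1})"

lemma tanner_edge_adj:
  assumes "e \<in> tanner_edges M" "edge_ends e = {x, y}"
  shows "tanner_adj M x y"
  using assms by (auto simp: tanner_edges_def edge_ends_def doubleton_eq_iff split: prod.splits)

text \<open>Length 1 would need a loop and length 2 two parallel edges. An entry at most 1 leaves
  only the edge copy with index 0, so two edges with the same ends coincide.\<close>

lemma tanner_cycle_imp_cycle:
  assumes "zero_one_mat M" "tanner_cycle M vs es"
  shows "cycle (tanner_adj M) (\<lambda>i. vs ! (i mod length vs)) (length vs)"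
proof -
  define n where "n = length vs"
  have n: "n > 0" "length es = n" "distinct vs" "distinct es" "set es \<subseteq> tanner_edges M"
    and ends: "\<And>i. i < n \<Longrightarrow> edge_ends (es ! i) = {vs ! i, vs ! (Suc i mod n)}"
    using assms(2) by (auto simp: tanner_cycle_def n_def)
  have adj: "tanner_adj M (vs ! i) (vs ! (Suc i mod n))" if "i < n" for i
    using ends[OF that] n(2,5) that by (intro tanner_edge_adj[of "es ! i"]) auto
  have "n \<noteq> 1" using adj[of 0] tanner_adj_irrefl by auto
  moreover have "n \<noteq> 2"
  proof
    assume n2: "n = 2"
    obtain a b k where e0: "es ! 0 = (a, b, k)" by (cases "es ! 0")
    obtain a' b' k' where e1: "es ! 1 = (a', b', k')" by (cases "es ! 1")
    have "es ! 0 \<in> tanner_edges M" "es ! 1 \<in> tanner_edges M" using n n2 by auto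
    moreover have "edge_ends (es ! 0) = edge_ends (es ! 1)"
      using ends[of 0] ends[of 1] n2 by (auto simp: numeral_2_eq_2)
    ultimately have "es ! 0 = es ! 1"
      using assms(1) e0 e1
      by (fastforce simp: zero_one_mat_def tanner_edges_def edge_ends_def doubleton_eq_iff)
    then show False using n n2 by (auto simp: nth_eq_iff_index_eq)
  qed
  moreover have "inj_on (\<lambda>i. vs ! (i mod n)) {..<n}"
    using n by (auto simp: inj_on_def nth_eq_iff_index_eq n_def)
  moreover have "3 \<le> n" using n(1) \<open>n \<noteq> 1\<close> \<open>n \<noteq> 2\<close> by linarith
  ultimately show ?thesis
    using adj by (auto simp: cycle_def walk_def n_def)
qed

lemma cycle_imp_tanner_cycle:
  assumes "cycle (tanner_adj M) c n"
  shows "\<exists>vs es. tanner_cycle M vs es \<and> length vs = n"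
proof -
  have n: "3 \<le> n" and inj: "inj_on c {..<n}" and w: "walk (tanner_adj M) c n" and c0: "c n = c 0"
    using assms by (auto simp: cycle_def)
  have "\<exists>e. e \<in> tanner_edges M \<and> edge_ends e = {c i, c (Suc i mod n)}" if "i < n" for i
  proof -
    have "c (Suc i mod n) = c (Suc i)" using that c0 by (auto simp: mod_Suc)
    moreover have "tanner_adj M (c i) (c (Suc i))" using w that by (auto simp: walk_def)
    moreover have "\<exists>e. e \<in> tanner_edges M \<and> edge_ends e = {x, y}" if "tanner_adj M x y" for x y
    proof -
      have "\<exists>a b. {x, y} = {Check a, Variable b} \<and> a < dim_row M \<and> b < dim_col M \<and> 0 < M $$ (a, b)"
        using that by (cases x; cases y) (auto simp: doubleton_eq_iff)
      then obtain a b where "{x, y} = {Check a, Variable b}" "a < dim_row M" "b < dim_col M"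
        "0 < M $$ (a, b)" by blast
      then show ?thesis by (intro exI[of _ "(a, b, 0)"]) (auto simp: tanner_edges_def edge_ends_def)
    qed
    ultimately show ?thesis by auto
  qed
  then obtain e where e: "\<And>i. i < n \<Longrightarrow> e i \<in> tanner_edges M"
    "\<And>i. i < n \<Longrightarrow> edge_ends (e i) = {c i, c (Suc i mod n)}" by metis
  \<comment> \<open>Equal edges at positions \<open>i < j\<close> would have their ends swapped,
    making each position the cyclic successor of the other; this is impossible for length at least
    3.\<close>
  have "inj_on e {..<n}"
  proof (rule linorder_inj_onI')
    fix i j assume ij: "i \<in> {..<n}" "j \<in> {..<n}" "i < j"
    show "e i \<noteq> e j"
    proof
      assume "e i = e j"
      then have "{c i, c (Suc i mod n)} = {c j, c (Suc j mod n)}" using e(2) ij by (metis lessThan_iff)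
      moreover have "c i \<noteq> c j" using inj ij by (auto simp: inj_on_def)
      ultimately have "c i = c (Suc j mod n)" "c (Suc i mod n) = c j" by (auto simp: doubleton_eq_iff)
      moreover have "Suc i mod n < n" "Suc j mod n < n" using n by auto
      ultimately have "i = Suc j mod n" "Suc i mod n = j"
        using inj_on_eq_iff[OF inj] ij by auto
      then show False using ij n by (auto simp: mod_Suc split: if_splits)
    qed
  qed
  then have "tanner_cycle M (map c [0..<n]) (map e [0..<n])"
    using inj e n by (auto simp: tanner_cycle_def distinct_map lessThan_atLeast0)
  then show ?thesis by (intro exI) auto
qed

lemma less_girth_iff:
  assumes "zero_one_mat M"
  shows "enat k < girth M \<longleftrightarrow> \<not> (\<exists>c n. n \<le> k \<and> cycle (tanner_adj M) c n)"
proof -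
  have "enat k < girth M \<longleftrightarrow>
      (\<forall>vs es. tanner_cycle M vs es \<longrightarrow> enat (Suc k) \<le> enat (length vs))"
    \<comment> \<open>A non-strict bound by \<open>Suc k\<close> passes to all elements under the
      infimum; this also covers infinite girth.\<close>
    unfolding girth_def Suc_ile_eq[symmetric] le_Inf_iff by blast
  also have "\<dots> \<longleftrightarrow> (\<forall>vs es. tanner_cycle M vs es \<longrightarrow> k < length vs)"
    by (simp add: Suc_le_eq)
  also have "\<dots> \<longleftrightarrow> \<not> (\<exists>c n. n \<le> k \<and> cycle (tanner_adj M) c n)" (is "?L \<longleftrightarrow> ?R")
  proof
    assume ?L
    then show ?R using cycle_imp_tanner_cycle[of M] by (metis not_le)
  next
    assume R: ?R
    show ?L
    proof (intro allI impI)
      fix vs es assume "tanner_cycle M vs es"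
      from tanner_cycle_imp_cycle[OF assms this] show "k < length vs" using R by (meson not_le)
    qed
  qed
  finally show ?thesis .
qed

subsection \<open>Walk counts as matrix entries\<close>

lemma sum_ge_1_iff:
  fixes f :: "'b \<Rightarrow> int"
  assumes "finite S" "\<And>i. i \<in> S \<Longrightarrow> 0 \<le> f i"
  shows "1 \<le> sum f S \<longleftrightarrow> (\<exists>i\<in>S. 1 \<le> f i)"
proof -
  have "1 \<le> sum f S \<longleftrightarrow> sum f S \<noteq> 0" using sum_nonneg[of S f] assms(2) by force
  also have "\<dots> \<longleftrightarrow> \<not> (\<forall>i\<in>S. f i = 0)" using assms by (subst sum_nonneg_eq_0_iff) auto
  also have "\<dots> \<longleftrightarrow> (\<exists>i\<in>S. 1 \<le> f i)" using assms(2) by force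
  finally show ?thesis .
qed

text \<open>Either one term is at least 2, the case \<open>i = j\<close>, or two different terms are
  positive. The two cases are merged into one formula to match
  \<open>multi_reach_add\<close>.\<close>

lemma sum_ge_2_iff:
  fixes f :: "'b \<Rightarrow> int"
  assumes "finite S" "\<And>i. i \<in> S \<Longrightarrow> 0 \<le> f i"
  shows "2 \<le> sum f S \<longleftrightarrow> (\<exists>i\<in>S. \<exists>j\<in>S. 1 \<le> f i \<and> 1 \<le> f j \<and> (i \<noteq> j \<or> 2 \<le> f i))" (is "?L \<longleftrightarrow> ?R")
proof -
  have split: "sum f S = f i + sum f (S - {i})" if "i \<in> S" for i
    using assms(1) that by (rule sum.remove)
  have rest: "1 \<le> sum f (S - {i}) \<longleftrightarrow> (\<exists>j\<in>S - {i}. 1 \<le> f j)" "0 \<le> sum f (S - {i})" for i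
    using assms by (auto intro!: sum_ge_1_iff sum_nonneg)
  show ?thesis
  proof
    assume ?L
    then obtain i where i: "i \<in> S" "1 \<le> f i" using sum_ge_1_iff[OF assms] by force
    show ?R
    proof (cases "2 \<le> f i")
      case False
      then have "1 \<le> sum f (S - {i})" using \<open>?L\<close> split[OF i(1)] by simp
      then show ?thesis using rest(1) i by blast
    qed (use i in blast)
  next
    assume ?R
    then obtain i j where ij: "i \<in> S" "j \<in> S" "1 \<le> f i" "1 \<le> f j" "i \<noteq> j \<or> 2 \<le> f i" by blast
    show ?L
    proof (cases "i = j")
      case True
      then show ?thesis using split[OF ij(1)] rest(2)[of i] ij by simp
    next
      case False
      then have "1 \<le> sum f (S - {i})" using rest(1)[of i] ij by blast
      then show ?thesis using split[OF ij(1)] ij by simp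
    qed
  qed
qed

lemma int_mult_ge_1_iff:
  fixes x y :: int
  assumes "0 \<le> x" "0 \<le> y"
  shows "1 \<le> x * y \<longleftrightarrow> 1 \<le> x \<and> 1 \<le> y"
  using assms zero_less_mult_iff[of x y] by (simp only: int_one_le_iff_zero_less) linarith

lemma int_mult_ge_2_iff:
  fixes x y :: int
  assumes "0 \<le> x" "0 \<le> y"
  shows "2 \<le> x * y \<longleftrightarrow> 1 \<le> x \<and> 1 \<le> y \<and> (2 \<le> x \<or> 2 \<le> y)"
proof (cases "x = 0 \<or> x = 1 \<or> y = 0 \<or> y = 1")
  case False
  then have "2 \<le> x" "2 \<le> y" using assms by auto
  then show ?thesis using mult_mono[of 2 x 2 y] by simp
qed (use assms in auto)

text \<open>
  Only the thresholds 1 and 2 of the walk counts matter, so their exact values are never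
  computed.
\<close>

definition detects_walks ::
    "int mat \<Rightarrow> (nat \<Rightarrow> tanner_node) \<Rightarrow> nat \<Rightarrow> int mat \<Rightarrow> bool" where
  "detects_walks M T n A \<longleftrightarrow> dim_row A = dim_row M \<and>
     (\<forall>a<dim_row A. \<forall>b<dim_col A. 0 \<le> A $$ (a, b) \<and>
        (1 \<le> A $$ (a, b) \<longleftrightarrow> reach (tanner_adj M) n (Check a) (T b)) \<and>
        (2 \<le> A $$ (a, b) \<longleftrightarrow> multi_reach (tanner_adj M) n (Check a) (T b)))"

text \<open>Since \<open>s\<close> is even, the node at position \<open>s\<close> is a check node
  and thus a summation index of the product. The threshold criteria for sums and products then agree
  with \<open>reach_add\<close> and \<open>multi_reach_add\<close>.\<close>

lemma detects_walks_mult: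
  assumes A: "detects_walks M Check s A" and B: "detects_walks M T r B"
    and dim: "dim_col A = dim_row M" and "even s"
  shows "detects_walks M T (s + r) (A * B)"
  unfolding detects_walks_def
proof (intro conjI allI impI)
  show "dim_row (A * B) = dim_row M" using A by (simp add: detects_walks_def)
  fix a b assume a: "a < dim_row (A * B)" and b: "b < dim_col (A * B)"
  let ?m = "dim_row M" and ?E = "tanner_adj M"
  have a': "a < ?m" "dim_row A = ?m" "dim_row B = ?m" "b < dim_col B"
    using a b A B by (auto simp: detects_walks_def)
  have A': "0 \<le> A $$ (a, i)" "1 \<le> A $$ (a, i) \<longleftrightarrow> reach ?E s (Check a) (Check i)"
    "2 \<le> A $$ (a, i) \<longleftrightarrow> multi_reach ?E s (Check a) (Check i)" if "i < ?m" for i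
    using A a' dim that by (auto simp: detects_walks_def)
  have B': "0 \<le> B $$ (i, b)" "1 \<le> B $$ (i, b) \<longleftrightarrow> reach ?E r (Check i) (T b)"
    "2 \<le> B $$ (i, b) \<longleftrightarrow> multi_reach ?E r (Check i) (T b)" if "i < ?m" for i
    using B a' that by (auto simp: detects_walks_def)
  have entry: "(A * B) $$ (a, b) = (\<Sum>i<?m. A $$ (a, i) * B $$ (i, b))"
    using a' dim by (simp add: scalar_prod_def lessThan_atLeast0)
  have nonneg: "0 \<le> A $$ (a, i) * B $$ (i, b)" if "i \<in> {..<?m}" for i
    using A'(1) B'(1) that by simp
  show "0 \<le> (A * B) $$ (a, b)" unfolding entry by (intro sum_nonneg nonneg)
  have mid: "\<exists>i<?m. z = Check i" if "reach ?E s (Check a) z" for z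
    using reach_even_Check[OF that \<open>even s\<close> a'(1)] .
  have "1 \<le> (A * B) $$ (a, b) \<longleftrightarrow>
      (\<exists>i<?m. reach ?E s (Check a) (Check i) \<and> reach ?E r (Check i) (T b))"
    unfolding entry using sum_ge_1_iff[OF finite_lessThan nonneg]
    by (auto simp: int_mult_ge_1_iff A' B')
  also have "\<dots> \<longleftrightarrow> reach ?E (s + r) (Check a) (T b)"
    unfolding reach_add[OF \<open>even s\<close>] using mid by blast
  finally show "1 \<le> (A * B) $$ (a, b) \<longleftrightarrow> reach ?E (s + r) (Check a) (T b)" .
  have "2 \<le> (A * B) $$ (a, b) \<longleftrightarrow> (\<exists>i<?m. \<exists>j<?m.
      reach ?E s (Check a) (Check i) \<and> reach ?E r (Check i) (T b) \<and>
      reach ?E s (Check a) (Check j) \<and> reach ?E r (Check j) (T b) \<and>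
      (i \<noteq> j \<or> multi_reach ?E s (Check a) (Check i) \<or> multi_reach ?E r (Check i) (T b)))"
    unfolding entry using sum_ge_2_iff[OF finite_lessThan nonneg]
    by (auto simp: int_mult_ge_1_iff int_mult_ge_2_iff A' B')
  also have "\<dots> \<longleftrightarrow> multi_reach ?E (s + r) (Check a) (T b)"
    (is "?L \<longleftrightarrow> ?R")
  proof
    assume ?L
    then show ?R unfolding multi_reach_add[OF \<open>even s\<close>] by (blast dest: tanner_node.inject(1)[THEN iffD1])
  next
    assume ?R
    then obtain z z' where z: "reach ?E s (Check a) z" "reach ?E r z (T b)"
      "reach ?E s (Check a) z'" "reach ?E r z' (T b)"
      "z \<noteq> z' \<or> multi_reach ?E s (Check a) z \<or> multi_reach ?E r z (T b)"
      unfolding multi_reach_add[OF \<open>even s\<close>] by blast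
    obtain i j where "i < ?m" "z = Check i" "j < ?m" "z' = Check j" using mid z(1,3) by blast
    then show ?L using z by blast
  qed
  finally show "2 \<le> (A * B) $$ (a, b) \<longleftrightarrow> multi_reach ?E (s + r) (Check a) (T b)" .
qed

lemma detects_walks_one: "detects_walks M Check 0 (1\<^sub>m (dim_row M))"
proof -
  have "reach (tanner_adj M) 0 x y \<longleftrightarrow> x = y" "\<not> multi_reach (tanner_adj M) 0 x y" for x y
    by (auto simp: reach_def multi_reach_def check_walk_def walk_def)
  then show ?thesis by (auto simp: detects_walks_def)
qed

text \<open>A walk of length 1 is determined by its ends, in accordance with entries that never
  reach 2.\<close>

lemma detects_walks_self:
  assumes "zero_one_mat M"
  shows "detects_walks M Variable 1 M"
proof -
  have "reach (tanner_adj M) 1 x y \<longleftrightarrow> tanner_adj M x y" for x y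
    by (auto simp: reach_def check_walk_def walk_def
        intro!: exI[of _ "\<lambda>i. if i = 0 then x else y"])
  moreover have "\<not> multi_reach (tanner_adj M) 1 x y" for x y
    unfolding multi_reach_def check_walk_def by (metis One_nat_def le_Suc_eq le_zero_eq)
  ultimately show ?thesis
    using assms by (fastforce simp: detects_walks_def zero_one_mat_def)
qed

text \<open>The zero diagonal excludes exactly the walks that return through the same variable node.
  Off the diagonal every summand is 0 or 1, so an entry is at least 2 only if there are two
  different common neighbours.\<close>

lemma detects_walks_common_neighbours:
  assumes M: "zero_one_mat M" and dim: "dim_row A = dim_row M" "dim_col A = dim_row M"
    and A: "\<And>a b. a < dim_row M \<Longrightarrow> b < dim_row M \<Longrightarrow>
      A $$ (a, b) = (if a = b then 0 else \<Sum>v<dim_col M. M $$ (a, v) * M $$ (b, v))"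
  shows "detects_walks M Check 2 A"
  unfolding detects_walks_def
proof (intro conjI allI impI)
  fix a b assume "a < dim_row A" "b < dim_col A"
  then have ab: "a < dim_row M" "b < dim_row M" using dim by auto
  let ?E = "tanner_adj M" and ?f = "\<lambda>v. M $$ (a, v) * M $$ (b, v)"
  have f: "?f v \<in> {0, 1}" "1 \<le> ?f v \<longleftrightarrow> ?E (Check a) (Variable v) \<and> ?E (Variable v) (Check b)"
    if "v < dim_col M" for v
  proof -
    have "M $$ (a, v) \<in> {0, 1}" "M $$ (b, v) \<in> {0, 1}"
      using M ab that by (auto simp: zero_one_mat_def)
    then show "?f v \<in> {0, 1}" "1 \<le> ?f v \<longleftrightarrow> ?E (Check a) (Variable v) \<and> ?E (Variable v) (Check b)"
      using ab that by auto
  qed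
  then have f': "0 \<le> ?f v" "\<not> 2 \<le> ?f v" if "v \<in> {..<dim_col M}" for v
    using that by fastforce+
  have walk_iff: "check_walk ?E 2 (Check a) (Check b) p \<longleftrightarrow> p 0 = Check a \<and> p 2 = Check b \<and> a \<noteq> b \<and>
      (\<exists>v<dim_col M. p 1 = Variable v \<and> 1 \<le> ?f v)" for p
  proof -
    have "check_walk ?E 2 x y p \<longleftrightarrow> p 0 = x \<and> p 2 = y \<and> x \<noteq> y \<and> ?E x (p 1) \<and> ?E (p 1) y" for x y
      by (auto simp: check_walk_def walk_def numeral_2_eq_2 less_Suc_eq)
    moreover have "?E (Check a) (p 1) \<and> ?E (p 1) (Check b) \<longleftrightarrow>
        (\<exists>v<dim_col M. p 1 = Variable v \<and> 1 \<le> ?f v)"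
      using f(2) tanner_adj_Check by metis
    ultimately show ?thesis by (metis tanner_node.inject(1))
  qed
  define path where "path v i = (if i = 0 then Check a else if i = 1 then Variable v else Check b)"
    for v and i :: nat
  have path: "path v 0 = Check a" "path v 1 = Variable v" "path v 2 = Check b" for v
    by (auto simp: path_def)
  have entry: "A $$ (a, b) = (if a = b then 0 else sum ?f {..<dim_col M})" using A ab by simp
  show "0 \<le> A $$ (a, b)" unfolding entry using f'(1) by (auto intro: sum_nonneg)
  have "reach ?E 2 (Check a) (Check b) \<longleftrightarrow> a \<noteq> b \<and> (\<exists>v<dim_col M. 1 \<le> ?f v)"
    unfolding reach_def walk_iff using path by metis
  then show "1 \<le> A $$ (a, b) \<longleftrightarrow> reach ?E 2 (Check a) (Check b)"
    unfolding entry using sum_ge_1_iff[OF finite_lessThan f'(1)] by auto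
  have "multi_reach ?E 2 (Check a) (Check b) \<longleftrightarrow>
      a \<noteq> b \<and> (\<exists>v<dim_col M. \<exists>w<dim_col M. 1 \<le> ?f v \<and> 1 \<le> ?f w \<and> v \<noteq> w)" (is "?L \<longleftrightarrow> ?R")
  proof
    assume ?L
    then obtain p q i where pq: "check_walk ?E 2 (Check a) (Check b) p"
      "check_walk ?E 2 (Check a) (Check b) q" "i \<le> 2" "p i \<noteq> q i" by (auto simp: multi_reach_def)
    from pq(3) consider "i = 0" | "i = 1" | "i = 2" by linarith
    then show ?R using pq(1,2,4) unfolding walk_iff by cases (auto, blast)
  next
    assume ?R
    then obtain v w where "a \<noteq> b" "v < dim_col M" "w < dim_col M" "1 \<le> ?f v" "1 \<le> ?f w" "v \<noteq> w"
      by blast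
    then have "check_walk ?E 2 (Check a) (Check b) (path v)"
      "check_walk ?E 2 (Check a) (Check b) (path w)" "path v 1 \<noteq> path w 1"
      unfolding walk_iff path by blast+
    then show ?L unfolding multi_reach_def using one_le_numeral by blast
  qed
  then show "2 \<le> A $$ (a, b) \<longleftrightarrow> multi_reach ?E 2 (Check a) (Check b)"
    unfolding entry using sum_ge_2_iff[OF finite_lessThan f'(1)] f'(2) by auto
qed (simp add: dim)

lemma detects_walks_pow:
  assumes "detects_walks M Check 2 A" "dim_col A = dim_row M"
  shows "detects_walks M Check (2 * k) (A ^\<^sub>m k)"
proof (induction k)
  case 0
  have "dim_row A = dim_row M" using assms by (simp add: detects_walks_def)
  then show ?case using detects_walks_one[of M] by simp
next
  case (Suc k)
  have "dim_row A = dim_row M" using assms by (simp add: detects_walks_def)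
  then have "dim_col (A ^\<^sub>m k) = dim_row M" using assms(2) by (cases k) auto
  from detects_walks_mult[OF Suc assms(1) this] show ?case by (simp add: algebra_simps)
qed

section \<open>Permutation blocks and the entries of \<open>C_matrix\<close>\<close>

lemma permutation_matrix_dim:
  assumes "permutation_matrix N A"
  shows "dim_row A = N" "dim_col A = N"
  using assms by (auto simp: permutation_matrix_def)

lemma permutation_matrix_entry:
  assumes "permutation_matrix N A" "x < N" "u < N"
  shows "A $$ (x, u) \<in> {0, 1}"
  using assms by (auto simp: permutation_matrix_def)

text \<open>A column holds a single 1 by injectivity of the permutation. Consequently two different
  rows of \<open>H\<close> in the same block row have no common variable node.\<close>

lemma permutation_matrix_column:
  assumes "permutation_matrix N A" "x < N" "y < N" "u < N" "x \<noteq> y"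
  shows "A $$ (x, u) * A $$ (y, u) = 0"
proof -
  obtain \<pi> where \<pi>: "\<pi> permutes {..<N}" "A = mat N N (\<lambda>(i, j). if \<pi> i = j then 1 else 0)"
    using assms(1) by (auto simp: permutation_matrix_def)
  have "\<pi> x \<noteq> \<pi> y" using permutes_inj[OF \<pi>(1)] assms(5) by (auto dest: injD)
  then show ?thesis using \<pi>(2) assms by auto
qed

lemma sum_block:
  fixes g :: "nat \<Rightarrow> int"
  shows "(\<Sum>k<n. \<Sum>u<N. g (k * N + u)) = (\<Sum>v<n * N. g v)"
proof -
  have "(\<Sum>u<N. g (k * N + u)) = sum g {k * N..<k * N + N}" for k
    using sum.shift_bounds_nat_ivl[of g 0 "k * N" N] by (simp add: lessThan_atLeast0 add.commute)
  then show ?thesis by (simp add: sum.nat_group)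
qed

text \<open>The definition erases whole diagonal blocks, whereas the right-hand side erases only the
  diagonal of \<open>H\<close> times its transpose. Both agree because the diagonal blocks of that
  product vanish off the diagonal.\<close>

lemma C_matrix_entry:
  assumes P: "\<And>i j. i < nc \<Longrightarrow> j < nv \<Longrightarrow> permutation_matrix N (P i j)" and "N \<ge> 1"
    and H: "H = block_matrix nc nv N P" and a: "a < nc * N" and b: "b < nc * N"
  shows "C_matrix nc nv N P $$ (a, b) =
    (if a = b then 0 else \<Sum>v<nv * N. H $$ (a, v) * H $$ (b, v))"
proof -
  have div: "a div N < nc" "b div N < nc" and md: "a mod N < N" "b mod N < N"
    using a b \<open>N \<ge> 1\<close> by (auto simp: less_mult_imp_div_less)
  have H_entry: "H $$ (c, k * N + u) = P (c div N) k $$ (c mod N, u)"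
    if "c < nc * N" "k < nv" "u < N" for c k u
  proof -
    have "k * N + u < nv * N"
      using that by (metis add.commute add_less_le_mono less_le_trans mult_Suc mult_le_mono1
          Suc_leI add_less_cancel_left)
    then show ?thesis using that by (simp add: H block_matrix_def)
  qed
  have H_sum: "(\<Sum>v<nv * N. H $$ (a, v) * H $$ (b, v)) =
      (\<Sum>k<nv. \<Sum>u<N. P (a div N) k $$ (a mod N, u) * P (b div N) k $$ (b mod N, u))"
    unfolding sum_block[symmetric] by (intro sum.cong refl) (simp add: H_entry a b)
  show ?thesis
  proof (cases "a div N = b div N")
    case True
    have "(\<Sum>v<nv * N. H $$ (a, v) * H $$ (b, v)) = 0" if "a \<noteq> b"
    proof -
      have "a mod N \<noteq> b mod N" using that True by (metis div_mult_mod_eq)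
      then show ?thesis unfolding H_sum True
        using P div md by (intro sum.neutral ballI permutation_matrix_column[where N = N]) auto
    qed
    then show ?thesis using True md a b by (simp add: C_matrix_def block_matrix_def)
  next
    case False
    then have "a \<noteq> b" by auto
    have "(P (a div N) k * transpose_mat (P (b div N) k)) $$ (a mod N, b mod N) =
        (\<Sum>u<N. P (a div N) k $$ (a mod N, u) * P (b div N) k $$ (b mod N, u))" if "k < nv" for k
      using permutation_matrix_dim[OF P[OF div(1) that]] permutation_matrix_dim[OF P[OF div(2) that]] md
      by (simp add: scalar_prod_def lessThan_atLeast0)
    then show ?thesis unfolding H_sum using False \<open>a \<noteq> b\<close> a b md
      by (simp add: C_matrix_def block_matrix_def C_block_def mat_sum_def)
  qed
qed

section \<open>The matrix condition entry by entry\<close>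

lemma mat_sum_mult_entry:
  assumes "\<And>s. s \<in> K \<Longrightarrow> F s \<in> carrier_mat n m" "B \<in> carrier_mat m w" "i < n" "j < w"
  shows "(mat_sum n m F K * B) $$ (i, j) = (\<Sum>s\<in>K. (F s * B) $$ (i, j))"
proof -
  have "(mat_sum n m F K * B) $$ (i, j) = (\<Sum>x<m. (\<Sum>s\<in>K. F s $$ (i, x)) * B $$ (x, j))"
    using assms by (simp add: mat_sum_def scalar_prod_def lessThan_atLeast0)
  also have "\<dots> = (\<Sum>s\<in>K. \<Sum>x<m. F s $$ (i, x) * B $$ (x, j))"
    by (simp add: sum_distrib_right sum.swap[of _ K])
  also have "\<dots> = (\<Sum>s\<in>K. (F s * B) $$ (i, j))"
  proof (rule sum.cong[OF refl])
    fix s assume "s \<in> K"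
    then have "F s \<in> carrier_mat n m" by (rule assms(1))
    then show "(\<Sum>x<m. F s $$ (i, x) * B $$ (x, j)) = (F s * B) $$ (i, j)"
      using assms(2-4) by (simp add: scalar_prod_def lessThan_atLeast0)
  qed
  finally show ?thesis .
qed

lemma mat_tri_eq_0_iff:
  assumes "A \<in> carrier_mat n w"
  shows "A \<triangle> B = 0\<^sub>m n w \<longleftrightarrow> (\<forall>a<n. \<forall>b<w. 2 \<le> A $$ (a, b) \<longrightarrow> B $$ (a, b) \<noteq> 0)"
  using assms by (auto simp: mat_tri_def mat_eq_iff tri_def)

theorem theorem5:
  fixes nc nv N l :: nat
    and P :: "nat \<Rightarrow> nat \<Rightarrow> int mat"
    and H C :: "int mat"
  assumes "nc \<ge> 2" and "nv \<ge> 1" and "N \<ge> 1"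
    and "\<And>i j. i < nc \<Longrightarrow> j < nv \<Longrightarrow> permutation_matrix N (P i j)"
    and "H = block_matrix nc nv N P"
    and "C = C_matrix nc nv N P"
    and "l \<ge> 2"
  shows "girth H > enat (2 * l) \<longleftrightarrow>
    (\<forall>t \<in> {2..l}.
       let m = nc * N;
           w = (if t mod 2 = 0 then m else nv * N);
           Hpow = (if t mod 2 = 0 then 1\<^sub>m m else H)
       in (C ^\<^sub>m (t div 2) * Hpow) \<triangle>
            (mat_sum m m (\<lambda>s. C ^\<^sub>m s) {..<t div 2} * Hpow) = 0\<^sub>m m w)"
proof -
  define m where "m = nc * N"
  let ?E = "tanner_adj H"
  have dimH: "dim_row H = m" "dim_col H = nv * N" and dimC: "dim_row C = m" "dim_col C = m"
    by (auto simp: assms(5,6) m_def block_matrix_def C_matrix_def)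
  have H01: "zero_one_mat H"
    unfolding zero_one_mat_def
  proof (intro allI impI)
    fix a b assume "a < dim_row H" "b < dim_col H"
    then have "H $$ (a, b) = P (a div N) (b div N) $$ (a mod N, b mod N)"
      "a div N < nc" "b div N < nv" "a mod N < N" "b mod N < N"
      using assms(3) by (auto simp: assms(5) block_matrix_def less_mult_imp_div_less)
    then show "H $$ (a, b) \<in> {0, 1}" using permutation_matrix_entry assms(4) by metis
  qed
  have "detects_walks H Check 2 C"
    using detects_walks_common_neighbours[OF H01, of C] C_matrix_entry[OF assms(4,3,5)] dimH dimC
    by (simp add: assms(6) m_def)
  then have C_pow: "detects_walks H Check (2 * k) (C ^\<^sub>m k)" for k
    by (rule detects_walks_pow) (simp add: dimC dimH)
  have C_carrier: "C ^\<^sub>m k \<in> carrier_mat m m" for k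
    using dimC by (intro pow_carrier_mat) auto
  have tri_iff: "(let m = nc * N;
           w = (if t mod 2 = 0 then m else nv * N);
           Hpow = (if t mod 2 = 0 then 1\<^sub>m m else H)
       in (C ^\<^sub>m (t div 2) * Hpow) \<triangle>
            (mat_sum m m (\<lambda>s. C ^\<^sub>m s) {..<t div 2} * Hpow) = 0\<^sub>m m w) \<longleftrightarrow>
     (\<forall>a<m. \<forall>y. multi_reach ?E t (Check a) y \<longrightarrow>
        (\<exists>s<t. even (t - s) \<and> reach ?E s (Check a) y))" for t
  proof -
    define w where "w = (if t mod 2 = 0 then m else nv * N)"
    define Hpow where "Hpow = (if t mod 2 = 0 then 1\<^sub>m m else H)"
    \<comment> \<open>\<open>T\<close> is the kind of node that the columns of \<open>Hpow\<close>
      stand for; with it both parities of \<open>t\<close> are treated at once, by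
      \<open>t = 2 * (t div 2) + t mod 2\<close>.\<close>
    define T where "T = (if t mod 2 = 0 then Check else Variable)"
    have Hpow: "detects_walks H T (t mod 2) Hpow" "Hpow \<in> carrier_mat m w"
      using detects_walks_one[of H] detects_walks_self[OF H01] dimH
      by (auto simp: T_def Hpow_def w_def mod2_eq_if)
    have CH: "detects_walks H T (2 * k + t mod 2) (C ^\<^sub>m k * Hpow)" for k
      using detects_walks_mult[OF C_pow Hpow(1)] C_carrier[of k] dimH by auto
    have CH_carrier: "C ^\<^sub>m k * Hpow \<in> carrier_mat m w" for k
      using C_carrier Hpow(2) by (rule mult_carrier_mat)
    have CH_entry: "0 \<le> (C ^\<^sub>m k * Hpow) $$ (a, b)"
      "1 \<le> (C ^\<^sub>m k * Hpow) $$ (a, b) \<longleftrightarrow> reach ?E (2 * k + t mod 2) (Check a) (T b)"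
      "2 \<le> (C ^\<^sub>m k * Hpow) $$ (a, b) \<longleftrightarrow> multi_reach ?E (2 * k + t mod 2) (Check a) (T b)"
      if "a < m" "b < w" for a b k
      using CH[of k] CH_carrier[of k] that unfolding detects_walks_def carrier_mat_def by blast+
    \<comment> \<open>The exponents \<open>k < t div 2\<close> correspond to the lengths
      \<open>2 * k + t mod 2\<close>, which are exactly the lengths below \<open>t\<close> of the
      same parity as \<open>t\<close>. By non-negativity, nonzero means at least 1.\<close>
    have sum_entry: "(mat_sum m m (\<lambda>s. C ^\<^sub>m s) {..<t div 2} * Hpow) $$ (a, b) \<noteq> 0 \<longleftrightarrow>
        (\<exists>s<t. even (t - s) \<and> reach ?E s (Check a) (T b))" if "a < m" "b < w" for a b
    proof -
      let ?S = "\<Sum>k<t div 2. (C ^\<^sub>m k * Hpow) $$ (a, b)"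
      have "(mat_sum m m (\<lambda>s. C ^\<^sub>m s) {..<t div 2} * Hpow) $$ (a, b) = ?S"
        using C_carrier Hpow(2) that by (intro mat_sum_mult_entry)
      moreover have "0 \<le> ?S" using CH_entry(1)[OF that] by (intro sum_nonneg)
      moreover have "1 \<le> ?S \<longleftrightarrow> (\<exists>k<t div 2. reach ?E (2 * k + t mod 2) (Check a) (T b))"
        using sum_ge_1_iff[of "{..<t div 2}" "\<lambda>k. (C ^\<^sub>m k * Hpow) $$ (a, b)"] CH_entry[OF that] by auto
      moreover have "(\<exists>k<t div 2. reach ?E (2 * k + t mod 2) (Check a) (T b)) \<longleftrightarrow>
          (\<exists>s<t. even (t - s) \<and> reach ?E s (Check a) (T b))"
      proof
        assume "\<exists>k<t div 2. reach ?E (2 * k + t mod 2) (Check a) (T b)"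
        then obtain k where k: "k < t div 2" "reach ?E (2 * k + t mod 2) (Check a) (T b)" by blast
        have "2 * k + t mod 2 < t \<and> even (t - (2 * k + t mod 2))" using k(1) by presburger
        with k(2) show "\<exists>s<t. even (t - s) \<and> reach ?E s (Check a) (T b)" by blast
      next
        assume "\<exists>s<t. even (t - s) \<and> reach ?E s (Check a) (T b)"
        then obtain s where s: "s < t" "even (t - s)" "reach ?E s (Check a) (T b)" by blast
        have "s div 2 < t div 2" "2 * (s div 2) + t mod 2 = s" using s(1,2) by presburger+
        with s(3) show "\<exists>k<t div 2. reach ?E (2 * k + t mod 2) (Check a) (T b)"
          by (intro exI[of _ "s div 2"]) simp
      qed
      moreover have "?S \<noteq> 0 \<longleftrightarrow> 1 \<le> ?S" using \<open>0 \<le> ?S\<close> by linarith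
      ultimately show ?thesis by metis
    qed
    \<comment> \<open>Every end of a check walk of length \<open>t\<close> labels a column, so
      quantifying over columns is the same as quantifying over all nodes \<open>y\<close>.\<close>
    have target: "\<exists>b<w. y = T b" if y: "reach ?E t (Check a) y" and a: "a < m" for a y
    proof -
      \<comment> \<open>Splitting off the even part leaves at most one edge after a check
        node.\<close>
      have "reach ?E (2 * (t div 2) + t mod 2) (Check a) y" using y by simp
      then obtain z where z: "reach ?E (2 * (t div 2)) (Check a) z" "reach ?E (t mod 2) z y"
        by (subst (asm) reach_add) auto
      obtain i where i: "i < m" "z = Check i"
        using reach_even_Check[OF z(1)] a dimH by auto
      show ?thesis
      proof (cases "t mod 2 = 0")
        case True
        then show ?thesis using z(2) i by (auto simp: reach_def check_walk_def T_def w_def)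
      next
        case False
        then have "?E (Check i) y"
          using z(2) i by (auto simp: reach_def check_walk_def walk_def mod2_eq_if split: if_splits)
        then show ?thesis using False dimH by (auto simp: tanner_adj_Check T_def w_def)
      qed
    qed
    have "(C ^\<^sub>m (t div 2) * Hpow) \<triangle>
            (mat_sum m m (\<lambda>s. C ^\<^sub>m s) {..<t div 2} * Hpow) = 0\<^sub>m m w \<longleftrightarrow>
        (\<forall>a<m. \<forall>b<w. multi_reach ?E t (Check a) (T b) \<longrightarrow>
          (\<exists>s<t. even (t - s) \<and> reach ?E s (Check a) (T b)))"
      unfolding mat_tri_eq_0_iff[OF CH_carrier] using CH_entry(3) sum_entry by simp
    also have "\<dots> \<longleftrightarrow> (\<forall>a<m. \<forall>y. multi_reach ?E t (Check a) y \<longrightarrow>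
          (\<exists>s<t. even (t - s) \<and> reach ?E s (Check a) y))" (is "?L \<longleftrightarrow> ?R")
    proof
      assume L: ?L
      show ?R
      proof (intro allI impI)
        fix a y assume a: "a < m" and y: "multi_reach ?E t (Check a) y"
        obtain b where "b < w" "y = T b" using target[OF multi_reach_imp_reach[OF y] a] by blast
        then show "\<exists>s<t. even (t - s) \<and> reach ?E s (Check a) y" using L a y by simp
      qed
    qed simp
    finally show ?thesis by (simp add: m_def[symmetric] w_def Hpow_def Let_def)
  qed
  show ?thesis
    unfolding less_girth_iff[OF H01] no_short_cycle_iff tri_iff dimH by blast
qed

end
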